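(* Let $U\subset\mathbb{C}^n$, $n\ge 2$, be a neighbourhood of the origin, let $F=(f_1,\ldots,f_m):U\to\mathbb{C}^m$ be a holomorphic mapping, and suppose $F(0)=0$. Define $S:=\{z\in U: f_1(z)\cdot\ldots\cdot f_m(z)=0\}$. Then $$\mathcal{L}_0(F)=\mathcal{L}_0(F|S).$$
   Context: $|\cdot|$ denotes the polycylindric (maximum) norm on $\mathbb{C}^n$ and $\mathbb{C}^m$, i.e. $|z|=\max_i|z_i|$. For a neighbourhood $U\subset\mathbb{C}^n$ ($n\ge 2$) of the origin, a holomorphic mapping $F:U\to\mathbb{C}^m$, and an analytic set $S\subset U$ in $U$ having $0\in\mathbb{C}^n$ as an accumulation point, put $$N(F|S):=\{\nu\in\mathbb{R}_+ : \exists A>0,\ \exists B>0,\ \forall z\in S,\ |z|<B\Rightarrow A|z|^\nu\le|F(z)|\}.$$ The Łojasiewicz exponent of $F|S$ at $0$ is $\mathcal{L}_0(F|S):=\inf N(F|S)$, with $\inf\emptyset=+\infty$. When $S=U$ one writes $N(F):=N(F|U)$ and $\mathcal{L}_0(F):=\inf N(F)$. *)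

theory Defs
  imports "HOL-Analysis.Analysis"
begin

(* infnorm is not usable here: on complex vectors it is the maximum of the moduli of the
   real and imaginary parts of the components, not of the components themselves. *)
definition polynorm :: "complex ^ 'n \<Rightarrow> real" where
  "polynorm z = Max (range (\<lambda>i. cmod (z $ i)))"

(* Complex Frechet differentiability at every point; the matrix J is the complex Jacobian.
   Meant for open U. *)
definition holomorphic_map_on :: "(complex ^ 'n \<Rightarrow> complex ^ 'm) \<Rightarrow> (complex ^ 'n) set \<Rightarrow> bool" where
  "holomorphic_map_on F U \<longleftrightarrow>
     (\<forall>z\<in>U. \<exists>J :: complex ^ 'n ^ 'm. (F has_derivative (\<lambda>v. J *v v)) (at z))"

(* Exponents range over the positive reals, which avoids the convention 0 powr 0 = 0 at z = 0.
   Admitting the exponent 0 would not change the infimum, as the set is upward closed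
   (shrink B to at most 1). *)
definition loja_exponents :: "(complex ^ 'n \<Rightarrow> complex ^ 'm) \<Rightarrow> (complex ^ 'n) set \<Rightarrow> real set" where
  "loja_exponents F S =
     {\<nu>. \<nu> > 0 \<and> (\<exists>A>0. \<exists>B>0. \<forall>z\<in>S.
        polynorm z < B \<longrightarrow> A * polynorm z powr \<nu> \<le> polynorm (F z))}"

(* In ereal, Inf {} = \<infinity>. *)
definition loja_exponent :: "(complex ^ 'n \<Rightarrow> complex ^ 'm) \<Rightarrow> (complex ^ 'n) set \<Rightarrow> ereal" where
  "loja_exponent F S = Inf (ereal ` loja_exponents F S)"

end

(* Restrict F to the complex lines in a direction v on which no f_i vanishes identically. Near the
   origin, t \<mapsto> f_i(z + t v) is a product of boundedly many factors t - t_j times a function bounded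
   above and below, uniformly in z. Let t* be the zero nearest to 0 among the zeros of all the f_i.
   Then |t* - t_j| \<le> 2 |t_j| for every j and every i, so |F(z + t* v)| \<le> K |F(z)|, and z + t* v
   lies in S. Outside a cone around v one also has |z + t* v| \<ge> c |z|, so an estimate on S
   transfers to z with the same exponent; as n \<ge> 2, two independent directions cover all z. *)
theory Submission
  imports Defs "HOL-Complex_Analysis.Conformal_Mappings"
begin

section \<open>Products of linear factors and modulus principles on a disc\<close>

lemma norm_prod_list_le:
  fixes x :: complex
  assumes "\<And>t. t \<in> set ts \<Longrightarrow> cmod (x - t) \<le> u"
  shows "cmod (\<Prod>t\<leftarrow>ts. x - t) \<le> u ^ length ts"
  using assms
proof (induction ts)
  case (Cons t ts)
  then have "cmod (x - t) * cmod (\<Prod>t\<leftarrow>ts. x - t) \<le> u * u ^ length ts"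
    by (intro mult_mono) (auto intro: order_trans[OF norm_ge_zero])
  then show ?case by (simp add: norm_mult)
qed auto

lemma norm_prod_list_ge:
  fixes x :: complex
  assumes "0 \<le> l" "\<And>t. t \<in> set ts \<Longrightarrow> l \<le> cmod (x - t)"
  shows "l ^ length ts \<le> cmod (\<Prod>t\<leftarrow>ts. x - t)"
  using assms
proof (induction ts)
  case (Cons t ts)
  then have "l * l ^ length ts \<le> cmod (x - t) * cmod (\<Prod>t\<leftarrow>ts. x - t)"
    by (intro mult_mono) auto
  then show ?case by (simp add: norm_mult)
qed auto

text \<open>Each factor obeys |x - t| \<le> |x| + |t| \<le> 2 |t|. This is where taking the nearest
  zero pays off: moving from \<open>0\<close> to \<open>x\<close> costs at most a factor 2 per
  zero.\<close>

lemma norm_prod_list_double: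
  fixes x :: complex
  assumes "\<And>t. t \<in> set ts \<Longrightarrow> cmod x \<le> cmod t"
  shows "cmod (\<Prod>t\<leftarrow>ts. x - t) \<le> 2 ^ length ts * cmod (\<Prod>t\<leftarrow>ts. 0 - t)"
  using assms
proof (induction ts)
  case (Cons t ts)
  have "cmod (x - t) \<le> cmod x + cmod t" by (rule norm_triangle_ineq4)
  also have "\<dots> \<le> 2 * cmod t" using Cons.prems[of t] by simp
  finally have "cmod (x - t) * cmod (\<Prod>t\<leftarrow>ts. x - t)
      \<le> 2 * cmod t * (2 ^ length ts * cmod (\<Prod>t\<leftarrow>ts. 0 - t))"
    using Cons by (intro mult_mono) auto
  then show ?case by (simp add: norm_mult mult_ac)
qed auto

lemma holomorphic_maximum_cball:
  assumes "h holomorphic_on cball 0 r" "0 < r"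
    and "\<And>t. cmod t = r \<Longrightarrow> cmod (h t) \<le> M" and "cmod x \<le> r"
  shows "cmod (h x) \<le> M"
proof (rule maximum_modulus_frontier[of h "cball 0 r"])
  show "h holomorphic_on interior (cball 0 r)"
    by (auto intro: holomorphic_on_subset[OF assms(1)])
  show "continuous_on (closure (cball 0 r)) h"
    using holomorphic_on_imp_continuous_on[OF assms(1)] by simp
qed (use assms in auto)

text \<open>The maximum principle applied to the reciprocal \<open>1 / h\<close>, which is
  holomorphic because \<open>h\<close> has no zeros on the disc.\<close>

lemma holomorphic_minimum_cball:
  assumes "h holomorphic_on cball 0 r" "0 < r" "0 < m"
    and nz: "\<And>t. cmod t \<le> r \<Longrightarrow> h t \<noteq> 0"
    and m: "\<And>t. cmod t = r \<Longrightarrow> m \<le> cmod (h t)" and x: "cmod x \<le> r"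
  shows "m \<le> cmod (h x)"
proof -
  have "cmod (1 / h x) \<le> 1 / m"
  proof (rule holomorphic_maximum_cball[where h = "\<lambda>t. 1 / h t" and r = r])
    show "(\<lambda>t. 1 / h t) holomorphic_on cball 0 r"
      using assms(1) nz by (intro holomorphic_intros) auto
    fix t :: complex assume "cmod t = r"
    then show "cmod (1 / h t) \<le> 1 / m"
      using m[of t] \<open>0 < m\<close> by (simp add: norm_divide frac_le)
  qed (use assms in auto)
  then show ?thesis using \<open>0 < m\<close> nz[OF x] by (simp add: norm_divide field_simps)
qed

section \<open>Splitting off the zeros of a function of one variable\<close>

text \<open>Every root has modulus below \<open>s\<close>, so on the circle of radius
  \<open>4 * s\<close> each linear factor has modulus at least \<open>3 * s\<close>. Dividing gives
  the bound there, and the maximum principle carries it inside.\<close>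

lemma cofactor_upper_bound:
  fixes g h :: "complex \<Rightarrow> complex"
  assumes hol: "h holomorphic_on cball 0 (4 * s)" and s: "0 < s"
    and fac: "\<And>t. cmod t \<le> 4 * s \<Longrightarrow> g t = (\<Prod>u\<leftarrow>ts. t - u) * h t"
    and ts: "\<And>u. u \<in> set ts \<Longrightarrow> cmod u < s"
    and upper: "\<And>t. cmod t \<le> 4 * s \<Longrightarrow> cmod (g t) \<le> b"
    and x: "cmod x \<le> 4 * s"
  shows "cmod (h x) \<le> b / (3 * s) ^ length ts"
proof (rule holomorphic_maximum_cball[OF hol])
  fix t :: complex assume t: "cmod t = 4 * s"
  have "(3 * s) ^ length ts \<le> cmod (\<Prod>u\<leftarrow>ts. t - u)"
  proof (rule norm_prod_list_ge)
    fix u assume "u \<in> set ts"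
    then show "3 * s \<le> cmod (t - u)" using ts[of u] t norm_triangle_ineq2[of t u] by linarith
  qed (use s in auto)
  then have "(3 * s) ^ length ts * cmod (h t) \<le> cmod (g t)"
    using fac[of t] t by (simp add: norm_mult mult_right_mono)
  also have "\<dots> \<le> b" using upper[of t] t by simp
  finally show "cmod (h t) \<le> b / (3 * s) ^ length ts" using s by (simp add: field_simps)
qed (use s x in auto)

text \<open>The counterpart of the upper bound: on the same circle each linear factor has modulus at
  most \<open>5 * s\<close>, and the minimum principle applies to the zero-free cofactor.\<close>

lemma cofactor_lower_bound:
  fixes g h :: "complex \<Rightarrow> complex"
  assumes hol: "h holomorphic_on cball 0 (4 * s)" and s: "0 < s" "0 < a"
    and fac: "\<And>t. cmod t \<le> 4 * s \<Longrightarrow> g t = (\<Prod>u\<leftarrow>ts. t - u) * h t"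
    and ts: "\<And>u. u \<in> set ts \<Longrightarrow> cmod u < s"
    and nz: "\<And>t. cmod t \<le> 4 * s \<Longrightarrow> h t \<noteq> 0"
    and lower: "\<And>t. cmod t = 4 * s \<Longrightarrow> a \<le> cmod (g t)"
    and x: "cmod x \<le> 4 * s"
  shows "a / (5 * s) ^ length ts \<le> cmod (h x)"
proof (rule holomorphic_minimum_cball[OF hol])
  fix t :: complex assume t: "cmod t = 4 * s"
  have "cmod (\<Prod>u\<leftarrow>ts. t - u) \<le> (5 * s) ^ length ts"
  proof (rule norm_prod_list_le)
    fix u assume "u \<in> set ts"
    then show "cmod (t - u) \<le> 5 * s" using ts[of u] t norm_triangle_ineq4[of t u] by linarith
  qed
  then have "cmod (g t) \<le> (5 * s) ^ length ts * cmod (h t)"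
    using fac[of t] t by (simp add: norm_mult mult_right_mono)
  then have "a \<le> (5 * s) ^ length ts * cmod (h t)" using lower[OF t] by linarith
  then show "a / (5 * s) ^ length ts \<le> cmod (h t)" using s by (simp add: field_simps)
qed (use s x nz in auto)

text \<open>At the point \<open>s\<close> each linear factor is at most \<open>2 * s\<close>, while
  the cofactor bound contains \<open>3 * s\<close> in the denominator for each root. Every root thus
  costs a factor 2/3, which limits their number in terms of \<open>a\<close> and \<open>b\<close>
  alone, uniformly in \<open>g\<close>.\<close>

lemma factorization_length_bound:
  fixes g h :: "complex \<Rightarrow> complex"
  assumes hol: "h holomorphic_on cball 0 (4 * s)" and s: "0 < s"
    and fac: "\<And>t. cmod t \<le> 4 * s \<Longrightarrow> g t = (\<Prod>u\<leftarrow>ts. t - u) * h t"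
    and ts: "\<And>u. u \<in> set ts \<Longrightarrow> cmod u < s"
    and lower: "\<And>t. s \<le> cmod t \<Longrightarrow> cmod t \<le> 4 * s \<Longrightarrow> a \<le> cmod (g t)"
    and upper: "\<And>t. cmod t \<le> 4 * s \<Longrightarrow> cmod (g t) \<le> b"
  shows "a \<le> b * (2/3) ^ length ts"
proof -
  let ?n = "length ts" and ?x = "complex_of_real s"
  have x: "cmod ?x = s" using s by simp
  have "cmod (\<Prod>u\<leftarrow>ts. ?x - u) \<le> (2 * s) ^ ?n"
  proof (rule norm_prod_list_le)
    fix u assume "u \<in> set ts"
    then show "cmod (?x - u) \<le> 2 * s"
      using ts[of u] norm_triangle_ineq4[of ?x u] x by linarith
  qed
  moreover have "cmod (h ?x) \<le> b / (3 * s) ^ ?n"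
    by (rule cofactor_upper_bound[OF hol s fac ts upper]) (use x s in auto)
  ultimately have "cmod (\<Prod>u\<leftarrow>ts. ?x - u) * cmod (h ?x) \<le> (2 * s) ^ ?n * (b / (3 * s) ^ ?n)"
    using s by (intro mult_mono) auto
  moreover have "a \<le> cmod (g ?x)" using lower[of ?x] x s by simp
  moreover have "g ?x = (\<Prod>u\<leftarrow>ts. ?x - u) * h ?x" using fac[of ?x] x s by simp
  ultimately have "a \<le> (2 * s) ^ ?n * (b / (3 * s) ^ ?n)" by (simp add: norm_mult)
  also have "\<dots> = b * (2/3) ^ ?n"
    using s by (simp add: power_mult_distrib power_divide field_simps)
  finally show ?thesis .
qed

lemma geometric_eventually_less:
  fixes a b q :: real
  assumes "0 < a" "\<bar>q\<bar> < 1"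
  obtains N where "\<And>n. n \<ge> N \<Longrightarrow> b * q ^ n < a"
proof -
  have "(\<lambda>n. b * q ^ n) \<longlonglongrightarrow> 0"
    using assms by (intro tendsto_mult_right_zero LIMSEQ_power_zero) auto
  then have "eventually (\<lambda>n. b * q ^ n < a) sequentially"
    using \<open>0 < a\<close> by (rule order_tendstoD)
  then show ?thesis using that by (auto simp: eventually_sequentially)
qed

text \<open>Zeros are split off one at a time; the bound on the number of linear factors forces the
  process to stop.\<close>

lemma exists_zero_free_factorization:
  fixes g :: "complex \<Rightarrow> complex"
  assumes hol: "g holomorphic_on ball 0 R" and s: "0 < s" "4 * s < R" and "0 < a" "0 < b"
    and lower: "\<And>t. s \<le> cmod t \<Longrightarrow> cmod t \<le> 4 * s \<Longrightarrow> a \<le> cmod (g t)"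
    and upper: "\<And>t. cmod t \<le> 4 * s \<Longrightarrow> cmod (g t) \<le> b"
  obtains ts h where "h holomorphic_on ball 0 R"
    "\<And>t. cmod t < R \<Longrightarrow> g t = (\<Prod>u\<leftarrow>ts. t - u) * h t"
    "\<And>u. u \<in> set ts \<Longrightarrow> cmod u < s"
    "\<And>t. cmod t \<le> 4 * s \<Longrightarrow> h t \<noteq> 0"
proof -
  define P where "P ts h \<longleftrightarrow> h holomorphic_on ball 0 R \<and>
    (\<forall>t. cmod t < R \<longrightarrow> g t = (\<Prod>u\<leftarrow>ts. t - u) * h t) \<and> (\<forall>u\<in>set ts. cmod u < s)"
    for ts h
  obtain N where N: "\<And>n. n \<ge> N \<Longrightarrow> b * (2/3) ^ n < a"
    using geometric_eventually_less[OF \<open>0 < a\<close>, of "2/3" b] by auto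
  have bound: "length ts < N" if "P ts h" for ts h
  proof (rule ccontr)
    assume "\<not> length ts < N"
    moreover have "a \<le> b * (2/3) ^ length ts"
    proof (rule factorization_length_bound[where h = h and g = g and s = s])
      show "h holomorphic_on cball 0 (4 * s)"
        using that s by (auto simp: P_def intro: holomorphic_on_subset)
    qed (use that s lower upper in \<open>auto simp: P_def\<close>)
    ultimately show False using N[of "length ts"] by simp
  qed
  (* In a factorization of maximal length the cofactor has no zeros left to split off. *)
  define Q where "Q n \<longleftrightarrow> (\<exists>ts h. P ts h \<and> length ts = n)" for n
  have "P [] g" using hol by (simp add: P_def)
  then have "Q 0" by (auto simp: Q_def)
  moreover have "\<And>n. Q n \<Longrightarrow> n \<le> N" using bound by (force simp: Q_def)
  ultimately obtain n where n: "Q n" "\<And>k. Q k \<Longrightarrow> k \<le> n"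
    using GreatestI_nat[of Q 0 N] Greatest_le_nat[of Q _ N] by metis
  then obtain ts h where P: "P ts h" and len: "length ts = n" by (auto simp: Q_def)
  have "h t \<noteq> 0" if t: "cmod t \<le> 4 * s" for t
  proof
    assume h0: "h t = 0"
    have "g t = 0" using P t s h0 by (simp add: P_def)
    \<comment> \<open>On the annulus between \<open>s\<close> and \<open>4 * s\<close> the modulus
      of \<open>g\<close> is at least \<open>a > 0\<close>, so a zero must lie in the inner
      disc.\<close>
    then have "cmod t < s" using lower[of t] t \<open>0 < a\<close> by (force simp: not_less)
    \<comment> \<open>The difference quotient of \<open>h\<close> at its zero \<open>t\<close>; the
      derivative as value at \<open>t\<close> removes the singularity, so \<open>k\<close> is again
      holomorphic.\<close>
    define k where "k w = (if w = t then deriv h t else (h w - h t) / (w - t))" for w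
    have holh: "h holomorphic_on ball 0 R" using P by (simp add: P_def)
    have k: "h w = (w - t) * k w" for w using h0 by (simp add: k_def)
    have "k holomorphic_on ball 0 R"
      by (rule pole_theorem_open_0[OF holh open_ball, of t]) (use k h0 in \<open>auto simp: k_def\<close>)
    then have "P (t # ts) k"
      using P \<open>cmod t < s\<close> k unfolding P_def by (simp add: mult_ac)
    then have "Q (Suc n)" using len by (auto simp: Q_def)
    then show False using n(2) by fastforce
  qed
  then show ?thesis using that[of h ts] P by (auto simp: P_def)
qed

text \<open>The constant is fixed before \<open>g\<close>, so it serves a whole family of functions.
  The point \<open>\<tau>\<close> need not be a zero of \<open>g\<close>, only no farther from 0
  than any zero in the disc; hence one \<open>\<tau>\<close> can serve several functions at
  once.\<close>

lemma holomorphic_nearest_zero_bound: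
  assumes "0 < s" "4 * s < R" "0 < a" "0 < b"
  obtains K :: real where "K > 0"
    "\<And>g \<tau>. g holomorphic_on ball 0 R
      \<Longrightarrow> (\<And>t. s \<le> cmod t \<Longrightarrow> cmod t \<le> 4 * s \<Longrightarrow> a \<le> cmod (g t))
      \<Longrightarrow> (\<And>t. cmod t \<le> 4 * s \<Longrightarrow> cmod (g t) \<le> b)
      \<Longrightarrow> cmod \<tau> \<le> 4 * s
      \<Longrightarrow> (\<And>t. cmod t \<le> 4 * s \<Longrightarrow> g t = 0 \<Longrightarrow> cmod \<tau> \<le> cmod t)
      \<Longrightarrow> cmod (g \<tau>) \<le> K * cmod (g 0)"
proof -
  obtain N where N: "\<And>n. n \<ge> N \<Longrightarrow> b * (2/3) ^ n < a"
    using geometric_eventually_less[OF \<open>0 < a\<close>, of "2/3" b] by auto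
  \<comment> \<open>Per root, the linear factor contributes 2 and the quotient of the two cofactor
    bounds contributes 5/3; the remaining quotient is \<open>b / a\<close>. There are fewer than
    \<open>N\<close> roots.\<close>
  show thesis
  proof (rule that[of "(10/3) ^ N * (b / a)"])
    show "(10/3) ^ N * (b / a) > 0" using assms by simp
    fix g :: "complex \<Rightarrow> complex" and \<tau> :: complex
    assume hol: "g holomorphic_on ball 0 R"
      and lower: "\<And>t. s \<le> cmod t \<Longrightarrow> cmod t \<le> 4 * s \<Longrightarrow> a \<le> cmod (g t)"
      and upper: "\<And>t. cmod t \<le> 4 * s \<Longrightarrow> cmod (g t) \<le> b"
      and \<tau>: "cmod \<tau> \<le> 4 * s"
      and near: "\<And>t. cmod t \<le> 4 * s \<Longrightarrow> g t = 0 \<Longrightarrow> cmod \<tau> \<le> cmod t"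
    obtain ts h where h: "h holomorphic_on ball 0 R"
      and fac: "\<And>t. cmod t < R \<Longrightarrow> g t = (\<Prod>u\<leftarrow>ts. t - u) * h t"
      and ts: "\<And>u. u \<in> set ts \<Longrightarrow> cmod u < s"
      and nz: "\<And>t. cmod t \<le> 4 * s \<Longrightarrow> h t \<noteq> 0"
      using exists_zero_free_factorization[OF hol assms lower upper] by metis
    let ?n = "length ts"
    have h': "h holomorphic_on cball 0 (4 * s)"
      using h assms by (auto intro: holomorphic_on_subset)
    have fac': "g t = (\<Prod>u\<leftarrow>ts. t - u) * h t" if "cmod t \<le> 4 * s" for t
      using fac that assms by simp
    have "?n < N"
      using factorization_length_bound[OF h' \<open>0 < s\<close> fac' ts lower upper] N[of ?n]
      by (simp add: not_le[symmetric]) fastforce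
    have "g u = 0" if "u \<in> set ts" for u
      using fac'[of u] ts[OF that] that \<open>0 < s\<close> by (auto simp: prod_list_zero_iff)
    then have "cmod \<tau> \<le> cmod u" if "u \<in> set ts" for u
      using near[of u] ts[OF that] that \<open>0 < s\<close> by simp
    then have P: "cmod (\<Prod>u\<leftarrow>ts. \<tau> - u) \<le> 2 ^ ?n * cmod (\<Prod>u\<leftarrow>ts. 0 - u)" (is "_ \<le> _ * ?P")
      by (rule norm_prod_list_double)
    have "a / (5 * s) ^ ?n \<le> cmod (h 0)"
      by (rule cofactor_lower_bound[OF h' _ _ fac' ts nz lower]) (use assms in auto)
    then have h0: "1 \<le> (5 * s) ^ ?n / a * cmod (h 0)"
      using assms by (simp add: field_simps)
    have "cmod (h \<tau>) \<le> b / (3 * s) ^ ?n * 1"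
      using cofactor_upper_bound[OF h' \<open>0 < s\<close> fac' ts upper \<tau>] by simp
    also have "\<dots> \<le> b / (3 * s) ^ ?n * ((5 * s) ^ ?n / a * cmod (h 0))"
      using h0 assms by (intro mult_left_mono) auto
    also have "\<dots> = (5/3) ^ ?n * (b / a) * cmod (h 0)"
      using assms by (simp add: power_mult_distrib power_divide field_simps)
    finally have "cmod (\<Prod>u\<leftarrow>ts. \<tau> - u) * cmod (h \<tau>)
        \<le> (2 ^ ?n * ?P) * ((5/3) ^ ?n * (b / a) * cmod (h 0))"
      using P by (intro mult_mono) auto
    also have "\<dots> = (10/3) ^ ?n * (b / a) * (?P * cmod (h 0))"
      by (simp add: power_mult_distrib[symmetric] mult_ac)
    also have "\<dots> \<le> (10/3) ^ N * (b / a) * (?P * cmod (h 0))"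
      using assms \<open>?n < N\<close> by (intro mult_right_mono power_increasing) auto
    finally show "cmod (g \<tau>) \<le> (10/3) ^ N * (b / a) * cmod (g 0)"
      using fac'[OF \<tau>] fac'[of 0] assms by (simp add: norm_mult)
  qed
qed

section \<open>Comparison of the polycylindric and the Euclidean norm\<close>

lemma polynorm_component: "cmod (z $ i) \<le> polynorm z"
  unfolding polynorm_def by (rule Max_ge) auto

lemma polynorm_le_iff: "polynorm z \<le> r \<longleftrightarrow> (\<forall>i. cmod (z $ i) \<le> r)"
  unfolding polynorm_def by (subst Max_le_iff) auto

lemma polynorm_nonneg: "0 \<le> polynorm z"
  \<comment> \<open>Here \<open>undefined\<close> is just some index; any component would
    do.\<close>
  using polynorm_component[of z undefined] norm_ge_zero order_trans by blast

lemma polynorm_le_norm: "polynorm z \<le> norm z"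
  by (simp add: polynorm_le_iff Finite_Cartesian_Product.norm_nth_le)

lemma norm_le_polynorm:
  fixes z :: "complex ^ 'n"
  shows "norm z \<le> real CARD('n) * polynorm z"
proof -
  have "norm z \<le> (\<Sum>i\<in>UNIV. norm (z $ i))"
    unfolding norm_vec_def by (rule L2_set_le_sum) auto
  also have "\<dots> \<le> (\<Sum>i\<in>(UNIV :: 'n set). polynorm z)"
    by (intro sum_mono polynorm_component)
  finally show ?thesis by simp
qed

section \<open>Complex lines and the restriction of holomorphic maps to them\<close>

lemma norm_vector_scalar_mult:
  fixes v :: "complex ^ 'n"
  shows "norm (t *s v) = cmod t * norm v"
  by (simp add: norm_vec_def norm_mult L2_set_right_distrib)

lemma linear_vector_scalar_mult_left: "linear (\<lambda>t::complex. t *s (v :: complex ^ 'n))"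
  by (rule linearI) (auto simp: vec_eq_iff algebra_simps)

lemma bounded_linear_vector_scalar_mult_left:
  "bounded_linear (\<lambda>t::complex. t *s (v :: complex ^ 'n))"
  using linear_vector_scalar_mult_left linear_conv_bounded_linear by blast

lemma continuous_on_line [continuous_intros]:
  "continuous_on T (\<lambda>t::complex. z + t *s (v :: complex ^ 'n))"
  by (intro continuous_on_add continuous_on_const
      bounded_linear.continuous_on[OF bounded_linear_vector_scalar_mult_left] continuous_on_id)

lemma holomorphic_map_on_subset:
  "holomorphic_map_on F U \<Longrightarrow> V \<subseteq> U \<Longrightarrow> holomorphic_map_on F V"
  by (auto simp: holomorphic_map_on_def)

lemma holomorphic_map_on_imp_continuous_on:
  assumes "holomorphic_map_on F U"
  shows "continuous_on U F"
proof (rule continuous_at_imp_continuous_on, rule ballI)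
  fix z assume "z \<in> U"
  then obtain J where "(F has_derivative (\<lambda>v. J *v v)) (at z)"
    using assms by (auto simp: holomorphic_map_on_def)
  then show "isCont F z" by (rule has_derivative_continuous)
qed

text \<open>By the chain rule the real derivative in \<open>t\<close> is
  \<open>h \<mapsto> (J *v (h *s v)) $ i\<close>. Since \<open>J\<close> is complex linear, this is
  multiplication by the complex number \<open>(J *v v) $ i\<close>, that is, a complex
  derivative.\<close>

lemma holomorphic_on_line:
  fixes F :: "complex ^ 'n \<Rightarrow> complex ^ 'm"
  assumes F: "holomorphic_map_on F U" and T: "open T" and U: "\<And>t. t \<in> T \<Longrightarrow> z + t *s v \<in> U"
  shows "(\<lambda>t. F (z + t *s v) $ i) holomorphic_on T"
proof -
  have "((\<lambda>t. F (z + t *s v) $ i) has_field_derivative D) (at t)"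
    if J: "(F has_derivative (\<lambda>v. J *v v)) (at (z + t *s v))" and D: "D = (J *v v) $ i" for t J D
  proof -
    have "((\<lambda>t. z + t *s v) has_derivative (\<lambda>h. 0 + h *s v)) (at t)"
      by (intro has_derivative_add has_derivative_const
          bounded_linear.has_derivative[OF bounded_linear_vector_scalar_mult_left] has_derivative_ident)
    then have "((\<lambda>t. z + t *s v) has_derivative (\<lambda>h. h *s v)) (at t)" by simp
    from has_derivative_compose[OF this J]
    have "((\<lambda>t. F (z + t *s v) $ i) has_derivative (\<lambda>h. (J *v (h *s v)) $ i)) (at t)"
      by (rule bounded_linear.has_derivative[OF bounded_linear_vec_nth])
    moreover have "(\<lambda>h. (J *v (h *s v)) $ i) = (\<lambda>h. D * h)"
      by (auto simp: D matrix_vector_mult_def sum_distrib_left mult_ac)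
    ultimately show ?thesis by (simp add: has_field_derivative_def)
  qed
  then have "\<exists>D. ((\<lambda>t. F (z + t *s v) $ i) has_field_derivative D) (at t)" if "t \<in> T" for t
    using F U[OF that] unfolding holomorphic_map_on_def by blast
  then show ?thesis using T by (auto simp: holomorphic_on_open)
qed

section \<open>Identity theorem and points where no component vanishes\<close>

text \<open>Reduction to one variable: on the complex line through \<open>a\<close> and
  \<open>z\<close> the component vanishes for parameters near 0. Convexity of \<open>B\<close> makes
  the set of admissible parameters connected, so the component also vanishes at parameter 1, which
  is \<open>z\<close>.\<close>

lemma holomorphic_map_component_eq_0:
  fixes F :: "complex ^ 'n \<Rightarrow> complex ^ 'm"
  assumes F: "holomorphic_map_on F B" and B: "open B" "convex B"
    and W: "open W" "W \<subseteq> B" "a \<in> W" "\<And>x. x \<in> W \<Longrightarrow> F x $ i = 0" and z: "z \<in> B"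
  shows "F z $ i = 0"
proof -
  define l where "l t = a + t *s (z - a)" for t
  have cont: "continuous_on UNIV l" unfolding l_def by (rule continuous_on_line)
  have "convex (l -` B)"
  proof (rule convexI)
    fix x y and u v :: real
    assume *: "x \<in> l -` B" "y \<in> l -` B" "0 \<le> u" "0 \<le> v" "u + v = 1"
    \<comment> \<open>The map \<open>l\<close> is affine rather than linear; writing
      \<open>a\<close> as \<open>(u + v) *\<^sub>R a\<close> distributes the base point over the
      convex combination.\<close>
    have "l (u *\<^sub>R x + v *\<^sub>R y) = (u + v) *\<^sub>R a + (u *\<^sub>R x + v *\<^sub>R y) *s (z - a)"
      using * by (simp add: l_def)
    also have "\<dots> = u *\<^sub>R l x + v *\<^sub>R l y"
      by (simp only: l_def) (simp add: vec_eq_iff algebra_simps)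
    finally show "u *\<^sub>R x + v *\<^sub>R y \<in> l -` B"
      using * convexD[OF B(2), of "l x" "l y" u v] by simp
  qed
  moreover have "open (l -` B)" "open (l -` W)"
    using cont B W by (auto intro: open_vimage)
  moreover have "0 \<in> l -` W" "1 \<in> l -` B" using W z by (auto simp: l_def)
  moreover have "(\<lambda>t. F (l t) $ i) holomorphic_on l -` B"
    unfolding l_def
    by (rule holomorphic_on_line[OF F]) (use \<open>open (l -` B)\<close> in \<open>auto simp: l_def[abs_def]\<close>)
  ultimately have "F (l 1) $ i = 0"
    using analytic_continuation_open[of "l -` W" "l -` B" "\<lambda>t. F (l t) $ i" "\<lambda>_. 0" 1] W
    by (auto simp: convex_connected)
  then show ?thesis by (simp add: l_def)
qed

text \<open>Induction over the components: by the identity theorem the next component is nonzero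
  somewhere in the open set found so far, and by continuity it stays nonzero on a smaller open
  set.\<close>

lemma exists_open_all_components_nonzero:
  fixes F :: "complex ^ 'n \<Rightarrow> complex ^ 'm"
  assumes F: "holomorphic_map_on F B" and B: "open B" "convex B" "B \<noteq> {}"
    and nz: "\<And>i. \<exists>z\<in>B. F z $ i \<noteq> 0"
  obtains W where "open W" "W \<noteq> {}" "W \<subseteq> B" "\<And>x i. x \<in> W \<Longrightarrow> F x $ i \<noteq> 0"
proof -
  have "\<exists>W. open W \<and> W \<noteq> {} \<and> W \<subseteq> B \<and> (\<forall>x\<in>W. \<forall>i\<in>I. F x $ i \<noteq> 0)" if "finite I" for I
    using that
  proof (induction I)
    case (insert i I)
    then obtain W where W: "open W" "W \<noteq> {}" "W \<subseteq> B" "\<forall>x\<in>W. \<forall>i\<in>I. F x $ i \<noteq> 0"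
      by blast
    then obtain x where x: "x \<in> W" "F x $ i \<noteq> 0"
      using holomorphic_map_component_eq_0[OF F B(1,2) W(1,3)] nz[of i] by blast
    have "continuous_on W (\<lambda>x. F x $ i)"
      using holomorphic_map_on_imp_continuous_on[OF F] W(3)
      by (intro continuous_on_component) (rule continuous_on_subset)
    then have "open (W \<inter> (\<lambda>x. F x $ i) -` (- {0}))"
      using W(1) by (intro continuous_open_preimage) auto
    then show ?case
      using W x by (intro exI[of _ "W \<inter> (\<lambda>x. F x $ i) -` (- {0})"]) auto
  qed (use B in auto)
  from this[of UNIV] show ?thesis using that by auto
qed

section \<open>Distance to two independent complex lines\<close>

text \<open>A point relatively close to both lines would make a multiple of \<open>v\<close> and a
  multiple of \<open>w\<close> nearly equal, against the lower bound for the injective linear map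
  \<open>L\<close>.\<close>

lemma norm_ge_outside_cone:
  fixes v w :: "complex ^ 'n"
  assumes indep: "\<And>t s. t *s v = s *s w \<Longrightarrow> t = 0 \<and> s = 0"
  obtains c where "c > 0"
    "\<And>z. (\<forall>t. c * norm z \<le> norm (z + t *s v)) \<or> (\<forall>t. c * norm z \<le> norm (z + t *s w))"
proof -
  define L where "L p = fst p *s v - snd p *s w" for p :: "complex \<times> complex"
  have "linear L" by (rule linearI) (auto simp: L_def vec_eq_iff algebra_simps)
  moreover have "inj L"
    using \<open>linear L\<close> indep by (auto simp: linear_injective_0 L_def zero_prod_def)
  ultimately obtain b where b: "b > 0" "\<And>p. b * norm p \<le> norm (L p)"
    using linear_inj_bounded_below_pos by blast
  have v: "norm v > 0" using indep[of 1 0] by (cases "v = 0") auto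
  \<comment> \<open>The bound 1/2 yields |z| < 2 |t| |v| for a violating \<open>t\<close>; the other
    bound then closes the chain b |t| < 2 c |z| \<le> 4 c |v| |t| \<le> b |t|.\<close>
  define c where "c = min (1/2) (b / (4 * norm v))"
  have c: "c > 0" "c \<le> 1/2" "c * (4 * norm v) \<le> b"
    using b v by (auto simp: c_def min_def field_simps)
  show thesis
  proof (rule that[OF c(1)], rule ccontr)
    fix z
    assume "\<not> ((\<forall>t. c * norm z \<le> norm (z + t *s v)) \<or> (\<forall>t. c * norm z \<le> norm (z + t *s w)))"
    then obtain t s where t: "norm (z + t *s v) < c * norm z" and s: "norm (z + s *s w) < c * norm z"
      by (auto simp: not_le)
    have "norm z - cmod t * norm v \<le> norm (z + t *s v)"
      using norm_triangle_ineq2[of z "- (t *s v)"] by (simp add: norm_vector_scalar_mult)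
    moreover have "c * norm z \<le> 1/2 * norm z" using c by (intro mult_right_mono) auto
    ultimately have z: "norm z < 2 * (cmod t * norm v)" using t by linarith
    have "b * cmod t \<le> b * norm (t, s)" using b norm_fst_le[of t s] by (intro mult_left_mono) auto
    also have "\<dots> \<le> norm ((z + t *s v) - (z + s *s w))" using b(2)[of "(t, s)"] by (simp add: L_def)
    also have "\<dots> < 2 * (c * norm z)" using t s norm_triangle_ineq4[of "z + t *s v" "z + s *s w"] by linarith
    also have "\<dots> \<le> c * (4 * norm v) * cmod t" using mult_left_mono[OF less_imp_le[OF z], of "2 * c"] c by (simp add: mult_ac)
    also have "\<dots> \<le> b * cmod t" using c by (intro mult_right_mono) auto
    finally show False by simp
  qed
qed

section \<open>The nearest zero on a line in a good direction\<close>

text \<open>On the line through the origin each component is bounded below on an annulus. Uniform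
  continuity passes this bound to the parallel lines through all small \<open>z\<close>, so the
  one-variable estimate applies with a single constant.\<close>

lemma exists_nearby_zero_along_direction:
  fixes F :: "complex ^ 'n \<Rightarrow> complex ^ 'm"
  assumes F: "holomorphic_map_on F U" and U: "ball 0 R \<subseteq> U" "v \<in> ball 0 R" and "F 0 = 0"
    and nz: "\<And>i. F v $ i \<noteq> 0" and V: "open V" "0 \<in> V" "V \<subseteq> U"
  obtains K \<delta> where "K > 0" "\<delta> > 0"
    "\<And>z. norm z < \<delta> \<Longrightarrow> \<exists>t. z + t *s v \<in> V \<and> (\<Prod>i\<in>UNIV. F (z + t *s v) $ i) = 0 \<and>
       polynorm (F (z + t *s v)) \<le> K * polynorm (F z)"
proof -
  have "v \<noteq> 0" using nz \<open>F 0 = 0\<close> by auto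
  then have v: "norm v > 0" by simp
  define T where "T = ball (0::complex) (R / norm v)"
  have T: "0 + t *s v \<in> U" if "t \<in> T" for t
    using that v by (intro subsetD[OF U(1)]) (simp add: T_def norm_vector_scalar_mult field_simps)
  \<comment> \<open>The product of the components vanishes at parameter 0 but not at 1, so its zero
    at 0 is isolated. This yields one punctured disc on which all components are nonzero.\<close>
  have "(\<lambda>t. \<Prod>i\<in>UNIV. F (0 + t *s v) $ i) holomorphic_on T"
    by (intro holomorphic_on_prod holomorphic_on_line[OF F]) (use T in \<open>auto simp: T_def\<close>)
  moreover have "1 \<in> T" using U v by (simp add: T_def)
  moreover then have "0 \<in> T" by (auto simp: T_def intro: less_trans[OF zero_less_one])
  moreover have "open T" "connected T" by (simp_all add: T_def)
  moreover have "(\<Prod>i\<in>UNIV. F (0 + 0 *s v) $ i) = 0" "(\<Prod>i\<in>UNIV. F (0 + 1 *s v) $ i) \<noteq> 0"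
    using nz \<open>F 0 = 0\<close> by auto
  ultimately obtain r where r: "r > 0"
    and "\<And>t. t \<in> ball 0 r - {0} \<Longrightarrow> (\<Prod>i\<in>UNIV. F (0 + t *s v) $ i) \<noteq> 0"
    using isolated_zeros[of "\<lambda>t. \<Prod>i\<in>UNIV. F (0 + t *s v) $ i" T 0 1] by metis
  then have rnz: "F (t *s v) $ i \<noteq> 0" if "cmod t < r" "t \<noteq> 0" for t i
    using that by auto
  obtain \<rho> where \<rho>: "\<rho> > 0" "cball 0 \<rho> \<subseteq> V"
    using V open_contains_cball_eq by blast
  \<comment> \<open>The first bound keeps the annulus inside the punctured disc of radius
    \<open>r\<close>; the second keeps \<open>t *s v\<close> within \<open>\<rho> / 2\<close>,
    leaving the other half of \<open>\<rho>\<close> for \<open>z\<close>.\<close>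
  define s where "s = min (r / 5) (\<rho> / (10 * norm v))"
  have s: "s > 0" "4 * s < 5 * s" "4 * s < r" "5 * s * norm v \<le> \<rho> / 2"
    using r \<rho> v by (auto simp: s_def min_def field_simps)
  have line: "z + t *s v \<in> cball 0 \<rho>" if "norm z \<le> \<rho> / 2" "cmod t \<le> 5 * s" for z t
  proof -
    have "norm (z + t *s v) \<le> norm z + cmod t * norm v"
      using norm_triangle_ineq[of z "t *s v"] by (simp add: norm_vector_scalar_mult)
    also have "cmod t * norm v \<le> 5 * s * norm v" using that by (intro mult_right_mono) auto
    finally show ?thesis using that s by simp
  qed
  have contV: "continuous_on (cball 0 \<rho>) F"
    using holomorphic_map_on_imp_continuous_on[OF F] \<rho> V by (meson continuous_on_subset subset_trans)
  have "bounded (F ` cball 0 \<rho>)"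
    using compact_continuous_image[OF contV] by (simp add: compact_imp_bounded)
  then obtain b where b: "b > 0" "\<And>x. x \<in> cball 0 \<rho> \<Longrightarrow> norm (F x) \<le> b"
    by (auto simp: bounded_pos)
  have "\<exists>a>0. \<forall>t. s \<le> cmod t \<longrightarrow> cmod t \<le> 4 * s \<longrightarrow> a \<le> cmod (F (t *s v) $ i)" for i
  proof -
    let ?A = "cball 0 (4 * s) - ball (0::complex) s"
    have "compact ?A" by (intro compact_diff) auto
    moreover have "complex_of_real s \<in> ?A" using s by auto
    moreover have "continuous_on ?A (\<lambda>t. cmod (F (0 + t *s v) $ i))"
      using line[of 0] s \<rho>
      by (intro continuous_on_norm continuous_on_component continuous_on_compose2[OF contV] continuous_on_line) auto
    ultimately obtain t0 where t0: "t0 \<in> ?A"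
      "\<forall>t\<in>?A. cmod (F (0 + t0 *s v) $ i) \<le> cmod (F (0 + t *s v) $ i)"
      using continuous_attains_inf[of ?A "\<lambda>t. cmod (F (0 + t *s v) $ i)"] by blast
    have "cmod (F (t0 *s v) $ i) > 0"
      using t0(1) s rnz[of t0 i] by (cases "t0 = 0") auto
    then show ?thesis using t0 by (intro exI[of _ "cmod (F (t0 *s v) $ i)"]) auto
  qed
  then obtain a' where a': "\<And>i. a' i > 0"
    "\<And>i t. s \<le> cmod t \<Longrightarrow> cmod t \<le> 4 * s \<Longrightarrow> a' i \<le> cmod (F (t *s v) $ i)"
    by metis
  \<comment> \<open>Half of the minimum, so that a perturbation smaller than \<open>a\<close> still
    leaves modulus at least \<open>a\<close>.\<close>
  define a where "a = Min (range a') / 2"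
  have a: "a > 0" using a'(1) by (simp add: a_def)
  have a2: "2 * a \<le> cmod (F (t *s v) $ i)" if "s \<le> cmod t" "cmod t \<le> 4 * s" for i t
  proof -
    have "2 * a \<le> a' i" by (simp add: a_def)
    also have "\<dots> \<le> cmod (F (t *s v) $ i)" using that by (rule a'(2))
    finally show ?thesis .
  qed
  have "uniformly_continuous_on (cball 0 \<rho>) F"
    using contV by (rule compact_uniformly_continuous) simp
  then obtain d where d: "d > 0"
    "\<And>x y. x \<in> cball 0 \<rho> \<Longrightarrow> y \<in> cball 0 \<rho> \<Longrightarrow> dist y x < d \<Longrightarrow> dist (F y) (F x) < a"
    using a unfolding uniformly_continuous_on_def by metis
  have close: "cmod (F (z + t *s v) $ i - F (t *s v) $ i) < a"
    if "norm z \<le> \<rho> / 2" "norm z < d" "cmod t \<le> 5 * s" for z t i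
  proof -
    have "dist (F (z + t *s v)) (F (0 + t *s v)) < a"
      using that \<rho> by (intro d(2) line) (auto simp: dist_norm)
    then show ?thesis
      using Finite_Cartesian_Product.norm_nth_le[of "F (z + t *s v) - F (t *s v)" i] by (simp add: dist_norm)
  qed
  obtain K where K: "K > 0"
    "\<And>g \<tau>. g holomorphic_on ball 0 (5 * s)
      \<Longrightarrow> (\<And>t. s \<le> cmod t \<Longrightarrow> cmod t \<le> 4 * s \<Longrightarrow> a \<le> cmod (g t))
      \<Longrightarrow> (\<And>t. cmod t \<le> 4 * s \<Longrightarrow> cmod (g t) \<le> b)
      \<Longrightarrow> cmod \<tau> \<le> 4 * s
      \<Longrightarrow> (\<And>t. cmod t \<le> 4 * s \<Longrightarrow> g t = 0 \<Longrightarrow> cmod \<tau> \<le> cmod t)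
      \<Longrightarrow> cmod (g \<tau>) \<le> K * cmod (g 0)"
    using holomorphic_nearest_zero_bound[OF s(1,2) a b(1)] by blast
  show thesis
  proof (rule that[OF K(1), of "min (\<rho> / 2) d"])
    show "min (\<rho> / 2) d > 0" using \<rho> d by simp
    fix z :: "complex ^ 'n" assume "norm z < min (\<rho> / 2) d"
    then have z: "norm z \<le> \<rho> / 2" "norm z < d" by auto
    define g where "g i t = F (z + t *s v) $ i" for i t
    have inV: "z + t *s v \<in> V" if "cmod t \<le> 5 * s" for t
      using line[OF z(1) that] \<rho> by auto
    have hol: "g i holomorphic_on ball 0 (5 * s)" for i
      unfolding g_def using inV V by (intro holomorphic_on_line[OF F]) auto
    then have hol4: "g i holomorphic_on cball 0 (4 * s)" for i
      by (rule holomorphic_on_subset) (use s in auto)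
    have lower: "a \<le> cmod (g i t)" if "s \<le> cmod t" "cmod t \<le> 4 * s" for i t
      using a2[OF that, of i] close[OF z, of t i] that s
        norm_triangle_ineq2[of "F (t *s v) $ i" "g i t"]
      by (simp add: g_def norm_minus_commute)
    have upper: "cmod (g i t) \<le> b" if "cmod t \<le> 4 * s" for i t
      using b(2)[OF line[OF z(1), of t]] Finite_Cartesian_Product.norm_nth_le[of "F (z + t *s v)" i] that s
      by (simp add: g_def)
    have g0: "cmod (g i 0) < a" for i
      using close[OF z, of 0 i] s \<open>F 0 = 0\<close> by (simp add: g_def)
    let ?Z = "cball 0 (4 * s) \<inter> (\<lambda>t. \<Prod>i\<in>UNIV. g i t) -` {0}"
    \<comment> \<open>Without a zero in the disc, the minimum principle would give modulus at least
      \<open>a\<close> at 0, contrary to \<open>g0\<close>. One arbitrary component, indexed by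
      \<open>undefined\<close>, suffices.\<close>
    have "\<exists>t. cmod t \<le> 4 * s \<and> (\<exists>i. g i t = 0)"
      using holomorphic_minimum_cball[OF hol4, of a undefined 0] lower[of _ undefined] g0[of undefined] a s
      by fastforce
    then obtain t i where "cmod t \<le> 4 * s" "g i t = 0" by blast
    then have "t \<in> ?Z" by (auto simp: prod_zero_iff)
    then have "?Z \<noteq> {}" by blast
    moreover have "compact ?Z"
      using holomorphic_on_imp_continuous_on[OF hol4]
      by (intro compact_eq_bounded_closed[THEN iffD2] conjI continuous_closed_preimage continuous_on_prod)
        (auto intro: bounded_subset[OF bounded_cball])
    \<comment> \<open>Minimality over the zeros of the product makes \<open>\<tau>\<close> no
      farther from 0 than any zero of any single component.\<close>
    ultimately obtain \<tau> where \<tau>: "\<tau> \<in> ?Z" "\<And>t. t \<in> ?Z \<Longrightarrow> cmod \<tau> \<le> cmod t"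
      using continuous_attains_inf[of ?Z cmod] continuous_on_norm_id by blast
    have "cmod (g i \<tau>) \<le> K * cmod (g i 0)" for i
      by (rule K(2)[OF hol lower upper]) (use \<tau> in auto)
    also have "K * cmod (g i 0) \<le> K * polynorm (F z)" for i
      using K(1) polynorm_component[of "F z" i] by (simp add: g_def)
    finally have "polynorm (F (z + \<tau> *s v)) \<le> K * polynorm (F z)"
      by (simp add: polynorm_le_iff g_def)
    then show "\<exists>t. z + t *s v \<in> V \<and> (\<Prod>i\<in>UNIV. F (z + t *s v) $ i) = 0 \<and>
       polynorm (F (z + t *s v)) \<le> K * polynorm (F z)"
      using \<tau> inV[of \<tau>] s by (intro exI[of _ \<tau>]) (auto simp: g_def)
  qed
qed

section \<open>Two good directions and the transfer of exponents\<close>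

text \<open>Dimension at least 2 provides a coordinate \<open>p\<close> besides one,
  \<open>q\<close>, where \<open>v\<close> is nonzero. Moving \<open>v\<close> slightly along
  \<open>p\<close> works: coordinate \<open>q\<close> forces \<open>t = s\<close>, then coordinate
  \<open>p\<close> forces \<open>s = 0\<close>.\<close>

lemma exists_independent_pair_in_open:
  fixes W :: "(complex ^ 'n) set"
  assumes "CARD('n) \<ge> 2" "open W" "v \<in> W" "v \<noteq> 0"
  obtains w where "w \<in> W" "\<And>t s. t *s v = s *s w \<Longrightarrow> t = 0 \<and> s = 0"
proof -
  obtain q where q: "v $ q \<noteq> 0" using \<open>v \<noteq> 0\<close> by (auto simp: vec_eq_iff)
  have "\<exists>p. p \<noteq> q"
  proof (rule ccontr)
    assume "\<not> (\<exists>p. p \<noteq> q)"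
    then have "(UNIV :: 'n set) = {q}" by auto
    then have "CARD('n) = 1" by (metis card.empty card.insert finite.emptyI empty_iff One_nat_def)
    then show False using assms(1) by simp
  qed
  then obtain p where p: "p \<noteq> q" by blast
  obtain e where e: "e > 0" "ball v e \<subseteq> W" using assms open_contains_ball_eq by blast
  define c where "c = e / (2 * norm (axis p (1::complex)))"
  have ax: "norm (axis p (1::complex)) > 0" by (simp add: axis_eq_0_iff)
  have c: "c > 0" using e ax by (simp add: c_def)
  define w where "w = v + of_real c *s axis p 1"
  show thesis
  proof (rule that[of w])
    have "norm (v - w) = c * norm (axis p (1::complex))"
      using c by (simp add: w_def norm_vector_scalar_mult)
    also have "\<dots> < e" using e ax by (simp add: c_def)
    finally show "w \<in> W" using e by (auto simp: dist_norm)
    fix t s assume eq: "t *s v = s *s w"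
    have "t * v $ q = s * v $ q"
      using arg_cong[OF eq, of "\<lambda>x. x $ q"] p by (simp add: w_def axis_def)
    then have "t = s" using q by simp
    moreover have "t * v $ p = s * (v $ p + of_real c)"
      using arg_cong[OF eq, of "\<lambda>x. x $ p"] by (simp add: w_def axis_def ring_distribs)
    ultimately have "s * of_real c = 0" by (simp add: ring_distribs)
    then show "t = 0 \<and> s = 0" using \<open>t = s\<close> c by simp
  qed
qed

text \<open>This is the substantial inclusion: each small \<open>z\<close> is compared with a point
  of the zero set on a line through \<open>z\<close>, at the cost of constants only, so the exponent
  survives.\<close>

lemma loja_exponents_zero_set_subset:
  fixes F :: "complex ^ 'n \<Rightarrow> complex ^ 'm" and U :: "(complex ^ 'n) set"
  assumes n: "CARD('n) \<ge> 2" and U: "open U" "0 \<in> U"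
    and F: "holomorphic_map_on F U" and "F 0 = 0"
  shows "loja_exponents F {z \<in> U. (\<Prod>i\<in>UNIV. F z $ i) = 0} \<subseteq> loja_exponents F U"
proof
  let ?S = "{z \<in> U. (\<Prod>i\<in>UNIV. F z $ i) = 0}" and ?C = "real CARD('n)"
  have C: "?C > 0" by simp
  fix \<nu> assume "\<nu> \<in> loja_exponents F ?S"
  then obtain A B where \<nu>: "\<nu> > 0" and A: "A > 0" and B: "B > 0"
    and S: "\<And>z. z \<in> ?S \<Longrightarrow> polynorm z < B \<Longrightarrow> A * polynorm z powr \<nu> \<le> polynorm (F z)"
    by (auto simp: loja_exponents_def)
  have near: "norm z < r" if "polynorm z < r / ?C" for z :: "complex ^ 'n" and r
    using norm_le_polynorm[of z] that C by (simp add: field_simps)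
  obtain R where R: "R > 0" "ball 0 R \<subseteq> U" using U open_contains_ball_eq by blast
  show "\<nu> \<in> loja_exponents F U"
  proof (cases "\<exists>i. \<forall>z\<in>ball 0 R. F z $ i = 0")
    \<comment> \<open>If a component vanishes on a whole ball, the zero set contains that ball and
      the estimate holds there already.\<close>
    case True
    then obtain i where "\<forall>z\<in>ball 0 R. F z $ i = 0" ..
    then have i: "F z $ i = 0" if "norm z < R" for z using that by simp
    have "A * polynorm z powr \<nu> \<le> polynorm (F z)" if "z \<in> U" "polynorm z < min B (R / ?C)" for z
      using that i[of z] near[of z R] by (intro S) auto
    then show ?thesis
      using \<nu> A B R C unfolding loja_exponents_def
      by (intro CollectI conjI exI[of _ A] exI[of _ "min B (R / ?C)"]) auto
  next
    case False
    then obtain W where W: "open W" "W \<noteq> {}" "W \<subseteq> ball 0 R" "\<And>x i. x \<in> W \<Longrightarrow> F x $ i \<noteq> 0"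
      using exists_open_all_components_nonzero[OF holomorphic_map_on_subset[OF F R(2)]] R by auto
    then obtain v where v: "v \<in> W" by blast
    then have "v \<noteq> 0" using W(4)[OF v, of undefined] \<open>F 0 = 0\<close> by auto
    then obtain w where w: "w \<in> W" "\<And>t s. t *s v = s *s w \<Longrightarrow> t = 0 \<and> s = 0"
      using exists_independent_pair_in_open[OF n W(1) v] by metis
    then obtain c where c: "c > 0"
      "\<And>z. (\<forall>t. c * norm z \<le> norm (z + t *s v)) \<or> (\<forall>t. c * norm z \<le> norm (z + t *s w))"
      using norm_ge_outside_cone by metis
    \<comment> \<open>The ball of radius \<open>B\<close> ensures that the estimate on the zero set
      is available at the point found, since \<open>polynorm\<close> is at most the Euclidean
      norm.\<close>
    define V where "V = U \<inter> ball 0 B"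
    have V: "open V" "0 \<in> V" "V \<subseteq> U" using U B by (auto simp: V_def)
    have inR: "x \<in> ball 0 R" if "x \<in> W" for x using W that by auto
    obtain Kv dv where Kv: "Kv > 0" "dv > 0"
      "\<And>z. norm z < dv \<Longrightarrow> \<exists>t. z + t *s v \<in> V \<and> (\<Prod>i\<in>UNIV. F (z + t *s v) $ i) = 0 \<and>
         polynorm (F (z + t *s v)) \<le> Kv * polynorm (F z)"
      using exists_nearby_zero_along_direction[OF F R(2) inR[OF v] \<open>F 0 = 0\<close> W(4)[OF v] V] by blast
    obtain Kw dw where Kw: "Kw > 0" "dw > 0"
      "\<And>z. norm z < dw \<Longrightarrow> \<exists>t. z + t *s w \<in> V \<and> (\<Prod>i\<in>UNIV. F (z + t *s w) $ i) = 0 \<and>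
         polynorm (F (z + t *s w)) \<le> Kw * polynorm (F z)"
      using exists_nearby_zero_along_direction[OF F R(2) inR[OF w(1)] \<open>F 0 = 0\<close> W(4)[OF w(1)] V] by blast
    define K where "K = max Kv Kw"
    have K: "K > 0" using Kv by (simp add: K_def)
    \<comment> \<open>The constant combines \<open>A * polynorm y powr \<nu> \<le> polynorm (F y)
      \<le> K * polynorm (F z)\<close> with \<open>c / ?C * polynorm z \<le> polynorm y\<close>,
      where \<open>y\<close> lies in the zero set.\<close>
    have "A * (c / ?C) powr \<nu> / K * polynorm z powr \<nu> \<le> polynorm (F z)"
      if z: "polynorm z < min dv dw / ?C" for z
    proof -
      have nz: "norm z < dv" "norm z < dw" using near[OF z] by auto
      have le: "Kv * polynorm (F z) \<le> K * polynorm (F z)" "Kw * polynorm (F z) \<le> K * polynorm (F z)"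
        by (auto simp: K_def intro: mult_right_mono polynorm_nonneg)
      obtain y where y: "y \<in> V" "(\<Prod>i\<in>UNIV. F y $ i) = 0"
        "polynorm (F y) \<le> K * polynorm (F z)" "c * norm z \<le> norm y"
        using c(2)[of z]
      proof
        assume cone: "\<forall>t. c * norm z \<le> norm (z + t *s v)"
        from Kv(3)[OF nz(1)] obtain t where "z + t *s v \<in> V" "(\<Prod>i\<in>UNIV. F (z + t *s v) $ i) = 0"
          "polynorm (F (z + t *s v)) \<le> Kv * polynorm (F z)" by blast
        then show thesis using that[of "z + t *s v"] cone le(1) by simp
      next
        assume cone: "\<forall>t. c * norm z \<le> norm (z + t *s w)"
        from Kw(3)[OF nz(2)] obtain t where "z + t *s w \<in> V" "(\<Prod>i\<in>UNIV. F (z + t *s w) $ i) = 0"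
          "polynorm (F (z + t *s w)) \<le> Kw * polynorm (F z)" by blast
        then show thesis using that[of "z + t *s w"] cone le(2) by simp
      qed
      have "c * polynorm z \<le> c * norm z" using c polynorm_le_norm by (intro mult_left_mono) auto
      also have "\<dots> \<le> ?C * polynorm y" using y(4) norm_le_polynorm[of y] by linarith
      finally have "c / ?C * polynorm z \<le> polynorm y" using C by (simp add: field_simps)
      then have "(c / ?C * polynorm z) powr \<nu> \<le> polynorm y powr \<nu>"
        using c \<nu> polynorm_nonneg[of z] by (intro powr_mono2) auto
      then have "A * ((c / ?C * polynorm z) powr \<nu>) \<le> A * polynorm y powr \<nu>"
        using A by simp
      also have "\<dots> \<le> polynorm (F y)"
        using y polynorm_le_norm[of y] by (intro S) (auto simp: V_def)
      also have "\<dots> \<le> K * polynorm (F z)" by (rule y(3))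
      finally show ?thesis
        using K c polynorm_nonneg[of z] by (simp add: powr_mult powr_divide field_simps)
    qed
    then show ?thesis
      using \<nu> A c K Kv Kw C unfolding loja_exponents_def
      by (intro CollectI conjI exI[of _ "A * (c / ?C) powr \<nu> / K"] exI[of _ "min dv dw / ?C"]) auto
  qed
qed

theorem theorem1:
  fixes F :: "complex ^ 'n \<Rightarrow> complex ^ 'm" and U :: "(complex ^ 'n) set"
  assumes "CARD('n) \<ge> 2"
    and "open U" and "0 \<in> U"
    and "holomorphic_map_on F U"
    and "F 0 = 0"
  shows "loja_exponent F U = loja_exponent F {z \<in> U. (\<Prod>i\<in>UNIV. F z $ i) = 0}"
proof -
  \<comment> \<open>An estimate on \<open>U\<close> restricts to any subset, so both sets of
    exponents coincide and so do their infima.\<close>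
  have "loja_exponents F U \<subseteq> loja_exponents F {z \<in> U. (\<Prod>i\<in>UNIV. F z $ i) = 0}"
    unfolding loja_exponents_def by blast
  with loja_exponents_zero_set_subset[OF assms] show ?thesis
    by (simp add: loja_exponent_def)
qed

end
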